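(* Let $X_1,X_2,\ldots$ be i.i.d. real random variables with common distribution function $F(x)=\mathsf P(X_1<x)$, let $H_\tau$ be an extreme value distribution function, and assume $F\in\max\text{-}DA(H_\tau)$. Let $N(t)=N_1(\Lambda(t))$, $t\ge 0$, be a Cox process led by the process $\Lambda(t)$ and independent of $X_1,X_2,\ldots$, and let $\Lambda$ be a nonnegative random variable. Let the functions $a(t)\in\mathbb R$, $b(t)>0$ and $d(t)>0$ be arbitrary. Put $$z_t(x)=d(t)\bigl[1-F\bigl(a(t)+b(t)x\bigr)\bigr],\qquad r_t(x)=z_t(x)+\log H_\tau(x).$$ Then for every $t\ge 0$, every $x\in\mathbb R$ such that $H_\tau(x)>0$, every $q\in(0,1)$ and every integer $M\ge 1$, $$\Big|\mathsf P\Big(\frac{1}{b(t)}\Big(\max_{1\le k\le N(t)}X_k-a(t)\Big)<x\Big)-\int_0^\infty H_\tau^\lambda(x)\,d\mathsf P(\Lambda<\lambda)\Big|$$ $$\le |r_t(x)|\sum_{k=1}^{M}B_{k,M}(q)\,|r_t(x)|^{k-1}\int_0^\infty\lambda^kH_\tau^\lambda(x)\,d\mathsf P(\Lambda<\lambda)+\mathsf P\Big(\Lambda>\frac{q}{|r_t(x)|}\Big)$$ $$+\,z_t(x)\int_0^\infty\bigl|\mathsf P(\Lambda(t)<\lambda d(t))-\mathsf P(\Lambda<\lambda)\bigr|e^{-\lambda z_t(x)}\,d\lambda,$$ where $$B_{k,M}(q)=\begin{cases}\dfrac{1}{k!}, & k=1,\ldots,M-1,\\[2mm] \dfrac{1+M(1-q)}{(M+1)!\,(1-q)},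 & k=M.\end{cases}$$
   Context: Distribution functions are left-continuous: $F(x)=\mathsf P(X<x)$. Integrals $\int_0^\infty g(\lambda)\,d\mathsf P(\Lambda<\lambda)$ mean $\mathsf E\,g(\Lambda)$ (over $[0,\infty)$, including a possible atom at $0$). $H_\tau^\lambda(x)=(H_\tau(x))^\lambda$. Extreme value distribution functions: up to location and scale parameters, $H_\tau$ ($\tau\in\mathbb R$) is $\exp\{-(1+\tau x)^{-1/\tau}\}$ where $1+\tau x>0$ (for $\tau=0$: $\exp\{-e^{-x}\}$, $x\in\mathbb R$), extended by $0$ when $\tau>0$ and $1+\tau x\le 0$, and by $1$ when $\tau<0$ and $1+\tau x\le0$. Equivalently, with $\gamma=1/|\tau|$ when $\tau\ne0$, it is up to location and scale one of: $\exp\{-x^{-\gamma}\}$ for $x>0$ and $0$ for $x\le0$ ($\tau>0$); $\exp\{-|x|^\gamma\}$ for $x<0$ and $1$ for $x\ge0$ ($\tau<0$); $\exp\{-e^{-x}\}$ ($\tau=0$). $F\in\max\text{-}DA(H_\tau)$ means that there are sequences of centering constants and positive normalizing constants such that the distribution functions of the linearly normalized maxima $\max_{1\le i\le n}X_i$ converge weakly to $H_\tau$. Cox process: $N(t)=N_1(\Lambda(t))$, where $N_1$ is a homogeneous Poisson process with unit intensity and the process $\Lambda(t)$, $t\ge0$, is independent of $N_1$, has $\Lambda(0)=0$, $\mathsf P(\Lambda(t)<\infty)=1$ for all $t>0$, and nondecreasing right-continuous sample paths. Convention: $\max_{1\le k\le N(t)}X_k=-\infty$ if $N(t)=0$. Conventions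 for the right-hand side: values $+\infty$ are allowed; $0\cdot\infty=0$; if $r_t(x)=0$, the first two terms are understood as $0$. *)

theory Defs
  imports "HOL-Probability.Probability"
begin

text \<open>Distribution functions are left-continuous.\<close>

definition left_cdf :: "'a measure \<Rightarrow> ('a \<Rightarrow> real) \<Rightarrow> real \<Rightarrow> real" where
  "left_cdf M Y x = \<P>(\<omega> in M. Y \<omega> < x)"

text \<open>Standard forms: \<open>\<tau> > 0\<close>, \<open>\<tau> < 0\<close> and \<open>\<tau> = 0\<close> are the Frechet, Weibull
  and Gumbel families, respectively.\<close>

definition gev_std :: "real \<Rightarrow> real \<Rightarrow> real" where
  "gev_std \<tau> x =
     (if \<tau> = 0 then exp (- exp (- x))
      else if 1 + \<tau> * x > 0 then exp (- ((1 + \<tau> * x) powr (- 1 / \<tau>)))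
      else if \<tau> > 0 then 0 else 1)"

definition extreme_value_df :: "real \<Rightarrow> (real \<Rightarrow> real) \<Rightarrow> bool" where
  "extreme_value_df \<tau> H \<longleftrightarrow>
     (\<exists>\<mu> \<sigma>. \<sigma> > 0 \<and> (\<forall>x. H x = gev_std \<tau> ((x - \<mu>) / \<sigma>)))"

definition iid_seq :: "'a measure \<Rightarrow> (nat \<Rightarrow> 'a \<Rightarrow> real) \<Rightarrow> bool" where
  "iid_seq M X \<longleftrightarrow>
     prob_space.indep_vars M (\<lambda>_. borel) X {1..} \<and>
     (\<forall>k\<ge>1. distr M borel (X k) = distr M borel (X 1))"

definition max_first :: "(nat \<Rightarrow> 'a \<Rightarrow> real) \<Rightarrow> nat \<Rightarrow> 'a \<Rightarrow> ereal" where
  "max_first X n \<omega> = (if n = 0 then -\<infinity> else ereal (Max ((\<lambda>k. X k \<omega>) ` {1..n})))"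

text \<open>Left-continuous distribution function of the maximum of the first \<open>\<nu>\<close> terms, centred by \<open>\<alpha>\<close>
  and divided by \<open>\<beta>\<close>; the number \<open>\<nu>\<close> of terms may be random.\<close>

definition norm_max_cdf ::
    "'a measure \<Rightarrow> (nat \<Rightarrow> 'a \<Rightarrow> real) \<Rightarrow> ('a \<Rightarrow> nat) \<Rightarrow> real \<Rightarrow> real \<Rightarrow> real \<Rightarrow> real" where
  "norm_max_cdf M X \<nu> \<alpha> \<beta> x =
     \<P>(\<omega> in M. ereal (1 / \<beta>) * (max_first X (\<nu> \<omega>) \<omega> - ereal \<alpha>) < ereal x)"

text \<open>For an i.i.d. sequence \<open>X\<close> this is a property of the common distribution function alone: it is
  membership of that distribution function in the max-domain of attraction of \<open>H\<close>.\<close>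

definition in_max_DA :: "'a measure \<Rightarrow> (nat \<Rightarrow> 'a \<Rightarrow> real) \<Rightarrow> (real \<Rightarrow> real) \<Rightarrow> bool" where
  "in_max_DA M X H \<longleftrightarrow>
     (\<exists>\<alpha> \<beta> :: nat \<Rightarrow> real. (\<forall>n. \<beta> n > 0) \<and>
        weak_conv (\<lambda>n. norm_max_cdf M X (\<lambda>_. n) (\<alpha> n) (\<beta> n)) H)"

definition sigma_process ::
    "'a measure \<Rightarrow> 'i set \<Rightarrow> 'b measure \<Rightarrow> ('i \<Rightarrow> 'a \<Rightarrow> 'b) \<Rightarrow> 'a set set" where
  "sigma_process M I S Y =
     sets (vimage_algebra (space M) (\<lambda>\<omega>. \<lambda>i\<in>I. Y i \<omega>) (PiM I (\<lambda>_. S)))"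

text \<open>\<open>indep_var\<close> is not applicable, since it requires both random elements to have the same type
  of values.\<close>

definition indep_processes ::
    "'a measure \<Rightarrow> 'i set \<Rightarrow> 'b measure \<Rightarrow> ('i \<Rightarrow> 'a \<Rightarrow> 'b) \<Rightarrow>
     'j set \<Rightarrow> 'c measure \<Rightarrow> ('j \<Rightarrow> 'a \<Rightarrow> 'c) \<Rightarrow> bool" where
  "indep_processes M I S Y J T Z \<longleftrightarrow>
     prob_space.indep_set M (sigma_process M I S Y) (sigma_process M J T Z)"

text \<open>Homogeneous Poisson process with unit intensity. The subtractions on \<open>nat\<close> do not truncate,
  since the paths are nondecreasing.\<close>

definition unit_poisson_process :: "'a measure \<Rightarrow> (real \<Rightarrow> 'a \<Rightarrow> nat) \<Rightarrow> bool" where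
  "unit_poisson_process M N\<^sub>1 \<longleftrightarrow>
     (\<forall>t\<ge>0. N\<^sub>1 t \<in> measurable M (count_space UNIV)) \<and>
     (\<forall>\<omega>\<in>space M. N\<^sub>1 0 \<omega> = 0 \<and> mono_on {0..} (\<lambda>t. N\<^sub>1 t \<omega>) \<and>
        (\<forall>t\<ge>0. continuous (at_right t) (\<lambda>s. N\<^sub>1 s \<omega>))) \<and>
     (\<forall>s\<ge>0. \<forall>t>s. distr M (count_space UNIV) (\<lambda>\<omega>. N\<^sub>1 t \<omega> - N\<^sub>1 s \<omega>)
        = measure_pmf (poisson_pmf (t - s))) \<and>
     (\<forall>(n::nat) ts. 0 \<le> ts 0 \<and> (\<forall>i<n. ts i < ts (Suc i)) \<longrightarrow>
        prob_space.indep_vars M (\<lambda>_. count_space UNIV)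
          (\<lambda>i \<omega>. N\<^sub>1 (ts (Suc i)) \<omega> - N\<^sub>1 (ts i) \<omega>) {..<n})"

definition controlling_process :: "'a measure \<Rightarrow> (real \<Rightarrow> 'a \<Rightarrow> ennreal) \<Rightarrow> bool" where
  "controlling_process M L \<longleftrightarrow>
     (\<forall>t\<ge>0. L t \<in> borel_measurable M) \<and>
     (\<forall>t>0. AE \<omega> in M. L t \<omega> < \<infinity>) \<and>
     (\<forall>\<omega>\<in>space M. L 0 \<omega> = 0 \<and> mono_on {0..} (\<lambda>t. L t \<omega>) \<and>
        (\<forall>t\<ge>0. continuous (at_right t) (\<lambda>s. L s \<omega>)))"

text \<open>The value of \<open>N t\<close> on the null event \<open>L t = \<infinity>\<close> is irrelevant and left unspecified; measurability
  of \<open>N t\<close> therefore has to be required.\<close>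

definition cox_process ::
    "'a measure \<Rightarrow> (real \<Rightarrow> 'a \<Rightarrow> nat) \<Rightarrow> (real \<Rightarrow> 'a \<Rightarrow> ennreal) \<Rightarrow> (real \<Rightarrow> 'a \<Rightarrow> nat) \<Rightarrow> bool" where
  "cox_process M N\<^sub>1 L N \<longleftrightarrow>
     unit_poisson_process M N\<^sub>1 \<and>
     controlling_process M L \<and>
     indep_processes M {0..} (count_space UNIV) N\<^sub>1 {0..} borel L \<and>
     (\<forall>t\<ge>0. N t \<in> measurable M (count_space UNIV)) \<and>
     (\<forall>t\<ge>0. \<forall>\<omega>\<in>space M. L t \<omega> < \<infinity> \<longrightarrow> N t \<omega> = N\<^sub>1 (enn2real (L t \<omega>)) \<omega>)"

definition B_coeff :: "nat \<Rightarrow> nat \<Rightarrow> real \<Rightarrow> real" where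
  "B_coeff k m q =
     (if k < m then 1 / fact k
      else (1 + real m * (1 - q)) / (fact (m + 1) * (1 - q)))"

end

theory Submission
  imports Defs
begin

text \<open>
  Write \<open>y = a t + b t x\<close>, \<open>U = L t / d t\<close> and \<open>w = - ln (H x) \<ge> 0\<close>, so that \<open>r = z - w\<close>. Conditioning on
  the number of terms and then on the leading process turns the distribution function of the maximum
  into \<open>E F(y)^N(t) = E exp (- z U)\<close>, while the limit law is \<open>E exp (- w \<Lambda>)\<close>. Both are compared with
  \<open>E exp (- z \<Lambda>)\<close>. Since \<open>exp (- z u)\<close> is the integral of \<open>z exp (- z l)\<close> over \<open>l > u\<close>, Fubini's
  theorem bounds the difference of the Laplace transforms of \<open>U\<close> and \<open>\<Lambda>\<close> by the integral of the
  difference of their distribution functions. The remaining difference is the expectation of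
  \<open>exp (- w \<Lambda>) \<bar>exp (- r \<Lambda>) - 1\<bar>\<close>: where \<open>\<bar>r\<bar> \<Lambda> \<le> q\<close> the exponential series is truncated at order
  \<open>m\<close>, and elsewhere the difference of the two exponentials is at most \<open>1\<close>.
\<close>

section \<open>Truncation of the exponential series\<close>

text \<open>\<open>B_coeff m m q\<close> is \<open>1 / m!\<close> times the sum of the geometric majorant
  \<open>1 + (q + q\<^sup>2 + \<dots>) / (m + 1)\<close> of the remainder of the exponential series.\<close>

lemma exp_minus_one_le_B_coeff:
  fixes s q :: real
  assumes "0 \<le> s" "s \<le> q" "q < 1" "m \<ge> 1"
  shows "exp s - 1 \<le> (\<Sum>k=1..m. B_coeff k m q * s ^ k)"
proof -
  have q: "0 \<le> q" using assms by simp
  let ?g = "\<lambda>i. s ^ m / fact m * (if i = 0 then 1 else q ^ i / real (m + 1))"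
  have sums_exp: "(\<lambda>k. s ^ k / fact k) sums exp s"
    using exp_converges[of s] by (simp add: field_simps scaleR_conv_of_real)
  then have tail: "(\<lambda>i. s ^ (i + m) / fact (i + m)) sums (exp s - (\<Sum>k<m. s ^ k / fact k))"
    by (rule sums_split_initial_segment)
  have "(\<lambda>i. q ^ i / real (m + 1)) sums (1 / (1 - q) / real (m + 1))"
    using q assms by (intro sums_divide geometric_sums) simp
  \<comment> \<open>The geometric series contributes \<open>1 / (m + 1)\<close> at index 0, where
    the majorant needs 1; a series with a single nonzero term supplies the difference.\<close>
  then have "(\<lambda>i. (if i = 0 then 1 - 1 / real (m + 1) else 0) + q ^ i / real (m + 1)) sums
      (1 - 1 / real (m + 1) + 1 / (1 - q) / real (m + 1))"
    by (intro sums_add sums_single)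
  also have "(\<lambda>i. (if i = 0 then 1 - 1 / real (m + 1) else 0) + q ^ i / real (m + 1)) =
      (\<lambda>i. if i = 0 then 1 else q ^ i / real (m + 1))"
    by auto
  finally have g: "?g sums (s ^ m / fact m * (1 - 1 / real (m + 1) + 1 / (1 - q) / real (m + 1)))"
    by (rule sums_mult)
  have "s ^ (i + m) / fact (i + m) \<le> ?g i" for i
  proof (cases "i = 0")
    case False
    \<comment> \<open>For \<open>i \<ge> 1\<close> the factorial gains at least the factor
      \<open>m + 1\<close>, because \<open>(m + 1)! \<le> (i + m)!\<close>; the remaining powers of
      \<open>s\<close> are bounded by those of \<open>q\<close>.\<close>
    have "s ^ i \<le> q ^ i" using assms by (intro power_mono) auto
    moreover have "fact m * real (m + 1) \<le> fact (i + m)"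
      using False fact_mono[of "Suc m" "i + m", where 'a = real] by (simp add: mult.commute)
    ultimately have "(s ^ m * s ^ i) / fact (i + m) \<le> (s ^ m * q ^ i) / (fact m * real (m + 1))"
      using assms q by (intro frac_le mult_left_mono mult_nonneg_nonneg) auto
    then show ?thesis using False by (simp add: power_add mult.commute)
  qed simp
  from sums_le[OF this tail g]
  have "exp s - (\<Sum>k<m. s ^ k / fact k)
      \<le> s ^ m / fact m * (1 - 1 / real (m + 1) + 1 / (1 - q) / real (m + 1))" .
  also have "1 - 1 / real (m + 1) + 1 / (1 - q) / real (m + 1)
      = (1 + real m * (1 - q)) / (real (m + 1) * (1 - q))"
  proof -
    have "1 - 1 / n + 1 / e / n = (1 + (n - 1) * e) / (n * e)" if "n \<noteq> 0" "e \<noteq> 0" for n e :: real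
      using that by (simp add: field_simps)
    from this[of "real (m + 1)" "1 - q"] show ?thesis using assms by simp
  qed
  also have "s ^ m / fact m * ((1 + real m * (1 - q)) / (real (m + 1) * (1 - q)))
      = B_coeff m m q * s ^ m"
    by (simp add: B_coeff_def mult_ac)
  also have "(\<Sum>k<m. s ^ k / fact k) = 1 + (\<Sum>k=1..<m. B_coeff k m q * s ^ k)"
  proof -
    \<comment> \<open>The coefficients below \<open>m\<close> are the Taylor coefficients, so
      splitting off index 0 leaves exactly the 1 that is subtracted from
      \<open>exp s\<close>.\<close>
    have "{..<m} = insert 0 {1..<m}" using assms by auto
    then show ?thesis by (simp add: B_coeff_def)
  qed
  moreover have "{1..m} = insert m {1..<m}" using assms by auto
  ultimately show ?thesis by simp
qed

text \<open>Negative exponents reduce to positive ones: \<open>1 - exp s \<le> exp (- s) - 1\<close>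
  is the inequality of the arithmetic and geometric means for \<open>exp s\<close> and
  \<open>exp (- s)\<close>.\<close>

lemma abs_exp_minus_one_le:
  fixes s q :: real
  assumes "\<bar>s\<bar> \<le> q" "q < 1" "m \<ge> 1"
  shows "\<bar>exp s - 1\<bar> \<le> (\<Sum>k=1..m. B_coeff k m q * \<bar>s\<bar> ^ k)"
proof -
  have "\<bar>exp s - 1\<bar> \<le> exp \<bar>s\<bar> - 1"
  proof (cases "s \<ge> 0")
    case False
    have "2 \<le> exp s + exp (- s)"
      using arith_geo_mean_sqrt[of "exp s" "exp (-s)"] by (simp flip: exp_add)
    with False show ?thesis by simp
  qed simp
  also have "\<dots> \<le> (\<Sum>k=1..m. B_coeff k m q * \<bar>s\<bar> ^ k)"
    using assms by (intro exp_minus_one_le_B_coeff) auto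
  finally show ?thesis .
qed

section \<open>Laplace transforms in terms of distribution functions\<close>

lemma nn_integral_exp_greaterThan:
  fixes u z :: real
  assumes "z > 0"
  shows "(\<integral>\<^sup>+l. ennreal (z * exp (- l * z)) * indicator {u<..} l \<partial>lborel) = ennreal (exp (- u * z))"
proof -
  \<comment> \<open>The fundamental theorem is applied on the closed half-line; the added endpoint
    \<open>u\<close> is a null set.\<close>
  have "(\<integral>\<^sup>+l. ennreal (z * exp (- l * z)) * indicator {u<..} l \<partial>lborel)
      = (\<integral>\<^sup>+l. ennreal (z * exp (- l * z)) * indicator {u..} l \<partial>lborel)"
    by (intro nn_integral_cong_AE eventually_mono[OF AE_lborel_singleton[of u]])
      (auto simp: indicator_def)
  also have "\<dots> = ennreal (0 - (- exp (- u * z)))"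
  proof (rule nn_integral_FTC_atLeast)
    have "LIM l at_top. l * z :> at_top"
      using assms by (intro filterlim_at_top_mult_tendsto_pos[OF tendsto_const] filterlim_ident)
    then have "((\<lambda>l. exp (- (l * z))) \<longlongrightarrow> 0) at_top"
      by (intro filterlim_compose[OF exp_at_bot] filterlim_compose[OF filterlim_uminus_at_bot_at_top])
    then show "((\<lambda>l. - exp (- l * z)) \<longlongrightarrow> 0) at_top"
      using tendsto_minus by fastforce
  qed (use assms in \<open>auto intro!: derivative_eq_intros\<close>)
  finally show ?thesis by simp
qed

context prob_space
begin

lemma borel_measurable_prob_less[measurable]:
  fixes U :: "'a \<Rightarrow> real"
  assumes [measurable]: "U \<in> borel_measurable M"
  shows "(\<lambda>l. \<P>(\<omega> in M. U \<omega> < l)) \<in> borel_measurable borel"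
  by (intro borel_measurable_mono monoI finite_measure_mono) auto

text \<open>The strict inequality in the event \<open>U \<omega> < l\<close> matches left-continuous
  distribution functions, and since \<open>U\<close> is nonnegative almost everywhere, restricting
  the thresholds to \<open>{0..}\<close> loses nothing. The Bochner form allows two such formulas to
  be subtracted.\<close>

lemma has_bochner_integral_laplace_cdf:
  fixes U :: "'a \<Rightarrow> real"
  assumes U[measurable]: "U \<in> borel_measurable M" and nonneg: "AE \<omega> in M. 0 \<le> U \<omega>" and z: "z > 0"
  shows "has_bochner_integral lborel
    (\<lambda>l. z * exp (- l * z) * \<P>(\<omega> in M. U \<omega> < l) * indicator {0..} l)
    (expectation (\<lambda>\<omega>. exp (- U \<omega> * z)))"
proof -
  interpret pair_sigma_finite M lborel ..
  have bounded: "AE \<omega> in M. norm (exp (- U \<omega> * z)) \<le> 1"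
    using nonneg z by (auto elim!: eventually_mono)
  have "(\<integral>\<^sup>+l. ennreal (z * exp (- l * z) * \<P>(\<omega> in M. U \<omega> < l) * indicator {0..} l) \<partial>lborel)
      = (\<integral>\<^sup>+l. (\<integral>\<^sup>+\<omega>. ennreal (z * exp (- l * z)) * indicator {0..} l
            * indicator {\<omega>\<in>space M. U \<omega> < l} \<omega> \<partial>M) \<partial>lborel)"
  proof (rule nn_integral_cong)
    fix l :: real
    show "ennreal (z * exp (- l * z) * \<P>(\<omega> in M. U \<omega> < l) * indicator {0..} l)
      = (\<integral>\<^sup>+\<omega>. ennreal (z * exp (- l * z)) * indicator {0..} l
            * indicator {\<omega>\<in>space M. U \<omega> < l} \<omega> \<partial>M)"
      using z by (cases "0 \<le> l")
        (simp_all add: nn_integral_cmult_indicator emeasure_eq_measure ennreal_mult')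
  qed
  \<comment> \<open>The event in \<open>\<omega>\<close> is reread as a half-line in
    \<open>l\<close>, in preparation for exchanging the integrals.\<close>
  also have "\<dots> = (\<integral>\<^sup>+l. (\<integral>\<^sup>+\<omega>. ennreal (z * exp (- l * z)) * indicator {0..} l
            * indicator {U \<omega><..} l \<partial>M) \<partial>lborel)"
    by (intro nn_integral_cong) (auto simp: indicator_def)
  also have "\<dots> = (\<integral>\<^sup>+\<omega>. (\<integral>\<^sup>+l. ennreal (z * exp (- l * z)) * indicator {0..} l
            * indicator {U \<omega><..} l \<partial>lborel) \<partial>M)"
    unfolding greaterThan_def indicator_def by (rule Fubini') measurable
  also have "\<dots> = (\<integral>\<^sup>+\<omega>. ennreal (exp (- U \<omega> * z)) \<partial>M)"
  proof (intro nn_integral_cong_AE eventually_mono[OF nonneg])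
    fix \<omega> assume "0 \<le> U \<omega>"
    then have "(\<integral>\<^sup>+l. ennreal (z * exp (- l * z)) * indicator {0..} l * indicator {U \<omega><..} l \<partial>lborel)
        = (\<integral>\<^sup>+l. ennreal (z * exp (- l * z)) * indicator {U \<omega><..} l \<partial>lborel)"
      by (intro nn_integral_cong) (auto simp: indicator_def)
    then show "(\<integral>\<^sup>+l. ennreal (z * exp (- l * z)) * indicator {0..} l * indicator {U \<omega><..} l \<partial>lborel)
        = ennreal (exp (- U \<omega> * z))"
      using nn_integral_exp_greaterThan[OF z] by simp
  qed
  also have "\<dots> = ennreal (expectation (\<lambda>\<omega>. exp (- U \<omega> * z)))"
    using bounded by (intro nn_integral_eq_integral integrable_const_bound[where B = 1]) auto
  finally show ?thesis
    using z by (intro has_bochner_integral_nn_integral) auto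
qed

end

text \<open>Each transform is an integral over \<open>l\<close> against the same weight, so the
  difference can be taken under the integral. Only the laws of \<open>U\<close> and \<open>V\<close>
  enter; hence the two may live on different spaces.\<close>

lemma laplace_difference_le:
  fixes U :: "'a \<Rightarrow> real" and V :: "'b \<Rightarrow> real"
  assumes M: "prob_space M" and P: "prob_space P"
    and U: "U \<in> borel_measurable M" "AE \<omega> in M. 0 \<le> U \<omega>"
    and V: "V \<in> borel_measurable P" "AE \<omega> in P. 0 \<le> V \<omega>"
    and z: "z \<ge> 0"
  shows "ennreal \<bar>(\<integral>\<omega>. exp (- U \<omega> * z) \<partial>M) - (\<integral>\<omega>. exp (- V \<omega> * z) \<partial>P)\<bar>
    \<le> ennreal z * (\<integral>\<^sup>+l\<in>{0..}. ennreal (\<bar>\<P>(\<omega> in M. U \<omega> < l) - \<P>(\<omega> in P. V \<omega> < l)\<bar>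
        * exp (- l * z)) \<partial>lborel)"
proof (cases "z = 0")
  \<comment> \<open>At \<open>z = 0\<close> both transforms equal 1, but the weight
    \<open>z * exp (- l * z)\<close> vanishes and cannot represent them.\<close>
  case True
  then show ?thesis using M P by (simp add: prob_space.prob_space)
next
  case False
  then have z: "z > 0" using z by simp
  note [measurable] = prob_space.borel_measurable_prob_less[OF M U(1)]
    prob_space.borel_measurable_prob_less[OF P V(1)]
  let ?D = "\<lambda>l. z * exp (- l * z) * \<P>(\<omega> in M. U \<omega> < l) * indicator {0..} l
    - z * exp (- l * z) * \<P>(\<omega> in P. V \<omega> < l) * indicator {0..} l"
  have "has_bochner_integral lborel ?D
      ((\<integral>\<omega>. exp (- U \<omega> * z) \<partial>M) - (\<integral>\<omega>. exp (- V \<omega> * z) \<partial>P))"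
    by (intro has_bochner_integral_diff prob_space.has_bochner_integral_laplace_cdf assms z)
  then have "ennreal \<bar>(\<integral>\<omega>. exp (- U \<omega> * z) \<partial>M) - (\<integral>\<omega>. exp (- V \<omega> * z) \<partial>P)\<bar>
      \<le> (\<integral>\<^sup>+l. ennreal (norm (?D l)) \<partial>lborel)"
    using integral_norm_bound_ennreal[of lborel ?D]
    by (simp add: has_bochner_integral_iff)
  also have "\<dots> = (\<integral>\<^sup>+l. ennreal z * (ennreal (\<bar>\<P>(\<omega> in M. U \<omega> < l) - \<P>(\<omega> in P. V \<omega> < l)\<bar>
        * exp (- l * z)) * indicator {0..} l) \<partial>lborel)"
    using z by (intro nn_integral_cong)
      (auto simp: indicator_def abs_mult mult_ac simp flip: ennreal_mult' right_diff_distrib)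
  also have "\<dots> = ennreal z * (\<integral>\<^sup>+l\<in>{0..}. ennreal (\<bar>\<P>(\<omega> in M. U \<omega> < l) - \<P>(\<omega> in P. V \<omega> < l)\<bar>
        * exp (- l * z)) \<partial>lborel)"
    by (rule nn_integral_cmult) measurable
  finally show ?thesis .
qed

section \<open>Perturbation of the exponent in the limit law\<close>

text \<open>The factorization \<open>exp (- v z) = h powr v * exp (- v r)\<close> isolates the error
  \<open>r\<close> in the exponent. The moments on the right may be infinite, so the pointwise bound
  is integrated as a nonnegative integral.\<close>

lemma powr_mean_difference_le:
  fixes V :: "'b \<Rightarrow> real"
  assumes P: "prob_space P"
    and V[measurable]: "V \<in> borel_measurable P" and nonneg: "AE \<omega> in P. 0 \<le> V \<omega>"
    and z: "z \<ge> 0" and h: "0 < h" "h \<le> 1" and q: "0 < q" "q < 1" and m: "m \<ge> 1"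
    and r: "r = z + ln h" "r \<noteq> 0"
  shows "ennreal \<bar>(\<integral>\<omega>. exp (- V \<omega> * z) \<partial>P) - (\<integral>\<omega>. h powr V \<omega> \<partial>P)\<bar>
    \<le> ennreal \<bar>r\<bar> * (\<Sum>k=1..m. ennreal (B_coeff k m q * \<bar>r\<bar> ^ (k - 1)) *
          (\<integral>\<^sup>+\<omega>. ennreal (V \<omega> ^ k * h powr V \<omega>) \<partial>P))
       + ennreal \<P>(\<omega> in P. V \<omega> > q / \<bar>r\<bar>)"
proof -
  interpret P: prob_space P by fact
  have B: "0 \<le> B_coeff k m q" for k
    using q by (auto simp: B_coeff_def)
  have h_le: "h powr v \<le> 1" if "0 \<le> v" for v :: real
    using that h by (simp add: powr_le1)
  have int: "integrable P (\<lambda>\<omega>. exp (- V \<omega> * z))" "integrable P (\<lambda>\<omega>. h powr V \<omega>)"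
    using nonneg z h_le by (auto intro!: P.integrable_const_bound[where B = 1])
  let ?T = "\<lambda>k \<omega>. ennreal (\<bar>r\<bar> * (B_coeff k m q * \<bar>r\<bar> ^ (k - 1))) * ennreal (V \<omega> ^ k * h powr V \<omega>)"
  have "ennreal \<bar>(\<integral>\<omega>. exp (- V \<omega> * z) \<partial>P) - (\<integral>\<omega>. h powr V \<omega> \<partial>P)\<bar>
      \<le> (\<integral>\<^sup>+\<omega>. ennreal \<bar>exp (- V \<omega> * z) - h powr V \<omega>\<bar> \<partial>P)"
    using integral_norm_bound_ennreal[of P "\<lambda>\<omega>. exp (- V \<omega> * z) - h powr V \<omega>"] int
    by simp
  also have "\<dots> \<le> (\<integral>\<^sup>+\<omega>. (\<Sum>k=1..m. ?T k \<omega>) + indicator {\<omega>\<in>space P. V \<omega> > q / \<bar>r\<bar>} \<omega> \<partial>P)"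
  proof (rule nn_integral_mono_AE, use nonneg AE_space in eventually_elim)
    fix \<omega> assume v: "0 \<le> V \<omega>" and \<omega>: "\<omega> \<in> space P"
    show "ennreal \<bar>exp (- V \<omega> * z) - h powr V \<omega>\<bar>
      \<le> (\<Sum>k=1..m. ?T k \<omega>) + indicator {\<omega>\<in>space P. V \<omega> > q / \<bar>r\<bar>} \<omega>"
    proof (cases "V \<omega> > q / \<bar>r\<bar>")
      case True
      \<comment> \<open>Two numbers in \<open>[0, 1]\<close> differ by at most 1, which the
        indicator alone pays for.\<close>
      have "exp (- V \<omega> * z) \<le> 1" using v z by simp
      moreover have "0 < exp (- V \<omega> * z)" by simp
      moreover have "0 \<le> h powr V \<omega>" by simp
      ultimately have "\<bar>exp (- V \<omega> * z) - h powr V \<omega>\<bar> \<le> 1"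
        using h_le[OF v] by linarith
      then have "ennreal \<bar>exp (- V \<omega> * z) - h powr V \<omega>\<bar> \<le> 1" by (simp add: ennreal_le_1)
      also have "\<dots> \<le> (\<Sum>k=1..m. ?T k \<omega>) + 1" by simp
      finally show ?thesis using True \<omega> by (simp add: indicator_def)
    next
      case False
      have "exp (- V \<omega> * z) = h powr V \<omega> * exp (- (V \<omega> * r))"
        using h by (simp add: powr_def r flip: exp_add) (simp add: algebra_simps)
      then have "\<bar>exp (- V \<omega> * z) - h powr V \<omega>\<bar> = \<bar>h powr V \<omega> * (exp (- (V \<omega> * r)) - 1)\<bar>"
        by (simp add: algebra_simps)
      also have "\<dots> = h powr V \<omega> * \<bar>exp (- (V \<omega> * r)) - 1\<bar>"
        by (simp add: abs_mult)
      also have "\<dots> \<le> h powr V \<omega> * (\<Sum>k=1..m. B_coeff k m q * \<bar>- (V \<omega> * r)\<bar> ^ k)"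
      proof (intro mult_left_mono abs_exp_minus_one_le)
        show "\<bar>- (V \<omega> * r)\<bar> \<le> q"
          using False v \<open>r \<noteq> 0\<close> by (simp add: abs_mult field_simps)
      qed (use q m in auto)
      also have "\<dots> = (\<Sum>k=1..m. \<bar>r\<bar> * (B_coeff k m q * \<bar>r\<bar> ^ (k - 1)) * (V \<omega> ^ k * h powr V \<omega>))"
        unfolding sum_distrib_left
      proof (intro sum.cong refl)
        fix k assume "k \<in> {1..m}"
        \<comment> \<open>Because the sum starts at \<open>k = 1\<close>, one factor
          \<open>\<bar>r\<bar>\<close> can be taken out of every term.\<close>
        then have "\<bar>r\<bar> ^ k = \<bar>r\<bar> * \<bar>r\<bar> ^ (k - 1)" by (cases k) auto
        then show "h powr V \<omega> * (B_coeff k m q * \<bar>- (V \<omega> * r)\<bar> ^ k)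
          = \<bar>r\<bar> * (B_coeff k m q * \<bar>r\<bar> ^ (k - 1)) * (V \<omega> ^ k * h powr V \<omega>)"
          using v by (simp add: abs_mult power_mult_distrib)
      qed
      finally have "ennreal \<bar>exp (- V \<omega> * z) - h powr V \<omega>\<bar>
        \<le> ennreal (\<Sum>k=1..m. \<bar>r\<bar> * (B_coeff k m q * \<bar>r\<bar> ^ (k - 1)) * (V \<omega> ^ k * h powr V \<omega>))"
        by (rule ennreal_leI)
      also have "\<dots> = (\<Sum>k=1..m. ennreal
          (\<bar>r\<bar> * (B_coeff k m q * \<bar>r\<bar> ^ (k - 1)) * (V \<omega> ^ k * h powr V \<omega>)))"
        using v B by (intro sum_ennreal[symmetric]) auto
      also have "\<dots> = (\<Sum>k=1..m. ?T k \<omega>)"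
        using v B by (intro sum.cong refl ennreal_mult) auto
      finally show ?thesis by (rule order_trans) simp
    qed
  qed
  also have "\<dots> = (\<Sum>k=1..m. ennreal (\<bar>r\<bar> * (B_coeff k m q * \<bar>r\<bar> ^ (k - 1))) *
          (\<integral>\<^sup>+\<omega>. ennreal (V \<omega> ^ k * h powr V \<omega>) \<partial>P))
       + ennreal \<P>(\<omega> in P. V \<omega> > q / \<bar>r\<bar>)"
    by (subst nn_integral_add) (auto simp: nn_integral_sum nn_integral_cmult P.emeasure_eq_measure)
  also have "(\<Sum>k=1..m. ennreal (\<bar>r\<bar> * (B_coeff k m q * \<bar>r\<bar> ^ (k - 1))) *
          (\<integral>\<^sup>+\<omega>. ennreal (V \<omega> ^ k * h powr V \<omega>) \<partial>P))
     = ennreal \<bar>r\<bar> * (\<Sum>k=1..m. ennreal (B_coeff k m q * \<bar>r\<bar> ^ (k - 1)) *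
          (\<integral>\<^sup>+\<omega>. ennreal (V \<omega> ^ k * h powr V \<omega>) \<partial>P))"
    unfolding sum_distrib_left by (intro sum.cong refl) (simp add: ennreal_mult' mult.assoc)
  finally show ?thesis .
qed

section \<open>Elementary facts on extreme value and Poisson laws\<close>

lemma extreme_value_df_le_one:
  assumes "extreme_value_df \<tau> H"
  shows "H x \<le> 1"
  using assms by (auto simp: extreme_value_df_def gev_std_def)

lemma integral_power_poisson:
  fixes c s :: real
  assumes "s > 0"
  shows "(\<integral>k. c ^ k \<partial>measure_pmf (poisson_pmf s)) = exp (- (s * (1 - c)))"
proof -
  have sums: "(\<lambda>k. exp (- s) * ((s * u) ^ k / fact k)) sums (exp (- s) * exp (s * u))" for u :: real
    using exp_converges[of "s * u"] by (intro sums_mult) (simp add: field_simps scaleR_conv_of_real)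
  have term_eq: "pmf (poisson_pmf s) k * u ^ k = exp (- s) * ((s * u) ^ k / fact k)" for u k
    using assms by (simp add: power_mult_distrib)
  \<comment> \<open>Since \<open>c\<close> may have any sign, absolute convergence is obtained from
    the same exponential series at \<open>\<bar>c\<bar>\<close>.\<close>
  have "norm (pmf (poisson_pmf s) k * c ^ k) = exp (- s) * ((s * \<bar>c\<bar>) ^ k / fact k)" for k
    using assms by (simp add: abs_mult power_abs power_mult_distrib)
  then have "summable (\<lambda>k. norm (pmf (poisson_pmf s) k * c ^ k))"
    using sums_summable[OF sums[of "\<bar>c\<bar>"]] by simp
  then have "(\<lambda>k. pmf (poisson_pmf s) k * c ^ k) sums
      (\<integral>k. pmf (poisson_pmf s) k * c ^ k \<partial>count_space UNIV)"
    by (intro sums_integral_count_space_nat) (simp add: integrable_count_space_nat_iff)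
  then have "(\<integral>k. pmf (poisson_pmf s) k * c ^ k \<partial>count_space UNIV) = exp (- s) * exp (s * c)"
    using sums[of c] unfolding term_eq by (rule sums_unique2)
  then show ?thesis
    by (simp add: measure_pmf_eq_density integral_density algebra_simps flip: exp_add)
qed

section \<open>Independence of processes and random indices\<close>

lemma indep_processes_sym:
  assumes "prob_space M" "indep_processes M I S Y J T Z"
  shows "indep_processes M J T Z I S Y"
proof -
  interpret prob_space M by fact
  have "prob (B \<inter> A) = prob B * prob A" if "prob (A \<inter> B) = prob A * prob B" for A B
    using that by (simp add: Int_commute mult.commute)
  then show ?thesis
    using assms(2) unfolding indep_processes_def indep_sets2_eq by blast
qed

context prob_space
begin

text \<open>A measurable functional of a path generates a sigma-algebra inside that of the process,
  so independence is inherited. This is how independence of whole processes yields independence of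
  the variables needed at fixed times.\<close>

lemma indep_processes_indep_var:
  assumes indep: "indep_processes M I S Y J T Z"
    and Y: "\<And>i \<omega>. i \<in> I \<Longrightarrow> \<omega> \<in> space M \<Longrightarrow> Y i \<omega> \<in> space S"
    and Z: "\<And>j \<omega>. j \<in> J \<Longrightarrow> \<omega> \<in> space M \<Longrightarrow> Z j \<omega> \<in> space T"
    and f: "f \<in> measurable (PiM I (\<lambda>_. S)) S'" and g: "g \<in> measurable (PiM J (\<lambda>_. T)) T'"
  shows "indep_var S' (\<lambda>\<omega>. f (\<lambda>i\<in>I. Y i \<omega>)) T' (\<lambda>\<omega>. g (\<lambda>j\<in>J. Z j \<omega>))"
proof -
  let ?VY = "vimage_algebra (space M) (\<lambda>\<omega>. \<lambda>i\<in>I. Y i \<omega>) (PiM I (\<lambda>_. S))"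
  let ?VZ = "vimage_algebra (space M) (\<lambda>\<omega>. \<lambda>j\<in>J. Z j \<omega>) (PiM J (\<lambda>_. T))"
  have indep: "sets ?VY \<subseteq> events" "sets ?VZ \<subseteq> events"
    "\<And>A B. A \<in> sets ?VY \<Longrightarrow> B \<in> sets ?VZ \<Longrightarrow> prob (A \<inter> B) = prob A * prob B"
    using indep by (auto simp: indep_processes_def sigma_process_def indep_sets2_eq)
  have f': "(\<lambda>\<omega>. f (\<lambda>i\<in>I. Y i \<omega>)) \<in> measurable ?VY S'"
    using Y by (intro measurable_compose[OF _ f] measurable_vimage_algebra1)
      (auto simp: space_PiM)
  have g': "(\<lambda>\<omega>. g (\<lambda>j\<in>J. Z j \<omega>)) \<in> measurable ?VZ T'"
    using Z by (intro measurable_compose[OF _ g] measurable_vimage_algebra1)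
      (auto simp: space_PiM)
  have "random_variable S' (\<lambda>\<omega>. f (\<lambda>i\<in>I. Y i \<omega>))"
    using f' indep(1) by (auto simp: measurable_def)
  moreover have "random_variable T' (\<lambda>\<omega>. g (\<lambda>j\<in>J. Z j \<omega>))"
    using g' indep(2) by (auto simp: measurable_def)
  moreover have "sigma_sets (space M) {(\<lambda>\<omega>. f (\<lambda>i\<in>I. Y i \<omega>)) -` A \<inter> space M |A. A \<in> sets S'} \<subseteq> sets ?VY"
    by (subst space_vimage_algebra[symmetric], rule sets.sigma_sets_subset)
      (use measurable_sets[OF f'] in auto)
  moreover have "sigma_sets (space M) {(\<lambda>\<omega>. g (\<lambda>j\<in>J. Z j \<omega>)) -` A \<inter> space M |A. A \<in> sets T'} \<subseteq> sets ?VZ"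
    by (subst space_vimage_algebra[symmetric], rule sets.sigma_sets_subset)
      (use measurable_sets[OF g'] in auto)
  ultimately show ?thesis
    unfolding indep_var_eq indep_sets2_eq using indep by (meson subset_trans subsetD)
qed

text \<open>\<open>indep_var\<close> needs a common type of values, hence the coercion of the index to \<open>real\<close>.\<close>

lemma expectation_random_index:
  fixes G :: "nat \<Rightarrow> 'a \<Rightarrow> real" and J :: "'a \<Rightarrow> nat"
  assumes J[measurable]: "J \<in> measurable M (count_space UNIV)"
    and indep: "\<And>j. indep_var borel (\<lambda>\<omega>. real (J \<omega>)) borel (G j)"
    and bounded: "\<And>j \<omega>. \<omega> \<in> space M \<Longrightarrow> 0 \<le> G j \<omega> \<and> G j \<omega> \<le> 1"
  shows "expectation (\<lambda>\<omega>. G (J \<omega>) \<omega>) = expectation (\<lambda>\<omega>. expectation (G (J \<omega>)))"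
proof -
  have [measurable]: "G j \<in> borel_measurable M" for j
    using indep by (rule indep_var_rv2)
  have int: "integrable M (G j)" for j
    using bounded by (intro integrable_const_bound[where B = 1]) auto
  define g where "g j = expectation (G j)" for j
  have g: "0 \<le> g j" "g j \<le> 1" for j
    using bounded integral_mono[OF int[of j] integrable_const[of 1]] prob_space
    by (auto simp: g_def intro!: integral_nonneg_AE)
  \<comment> \<open>The decomposition over the values of \<open>J\<close> is kept generic in
    \<open>K\<close> because it is used twice: for \<open>G\<close> and for the constants
    \<open>g\<close>. Nonnegative integrals permit the exchange with the series.\<close>
  have sum_split: "(\<integral>\<^sup>+\<omega>. ennreal (K (J \<omega>) \<omega>) \<partial>M)
      = (\<Sum>j. ennreal (expectation (\<lambda>\<omega>. indicator {j} (J \<omega>) * K j \<omega>)))"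
    if [measurable]: "\<And>j. K j \<in> borel_measurable M"
      and K: "\<And>j \<omega>. \<omega> \<in> space M \<Longrightarrow> 0 \<le> K j \<omega> \<and> K j \<omega> \<le> 1" for K :: "nat \<Rightarrow> 'a \<Rightarrow> real"
  proof -
    have [measurable]: "(\<lambda>\<omega>. indicator {j} (J \<omega>) :: real) \<in> borel_measurable M" for j
      by (rule measurable_compose[OF J]) simp
    have int_K: "integrable M (\<lambda>\<omega>. indicator {j} (J \<omega>) * K j \<omega>)" for j
    proof (rule integrable_const_bound[where B = 1])
      show "AE \<omega> in M. norm (indicator {j} (J \<omega>) * K j \<omega>) \<le> 1"
        using K by (auto simp: indicator_def)
    qed measurable
    have "(\<integral>\<^sup>+\<omega>. ennreal (K (J \<omega>) \<omega>) \<partial>M)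
        = (\<integral>\<^sup>+\<omega>. (\<Sum>j. ennreal (indicator {j} (J \<omega>) * K j \<omega>)) \<partial>M)"
    proof (rule nn_integral_cong)
      fix \<omega>
      have "(\<Sum>j. ennreal (indicator {j} (J \<omega>) * K j \<omega>))
          = (\<Sum>j\<in>{J \<omega>}. ennreal (indicator {j} (J \<omega>) * K j \<omega>))"
        by (rule suminf_finite) (auto simp: indicator_def)
      then show "ennreal (K (J \<omega>) \<omega>) = (\<Sum>j. ennreal (indicator {j} (J \<omega>) * K j \<omega>))"
        by simp
    qed
    also have "\<dots> = (\<Sum>j. (\<integral>\<^sup>+\<omega>. ennreal (indicator {j} (J \<omega>) * K j \<omega>) \<partial>M))"
      by (rule nn_integral_suminf) measurable
    also have "\<dots> = (\<Sum>j. ennreal (expectation (\<lambda>\<omega>. indicator {j} (J \<omega>) * K j \<omega>)))"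
      using K by (intro arg_cong[where f = suminf] ext nn_integral_eq_integral int_K)
        (auto simp: indicator_def)
    finally show ?thesis .
  qed
  have "(\<integral>\<^sup>+\<omega>. ennreal (G (J \<omega>) \<omega>) \<partial>M) = (\<integral>\<^sup>+\<omega>. ennreal (g (J \<omega>)) \<partial>M)"
  proof -
    have eq: "expectation (\<lambda>\<omega>. indicator {j} (J \<omega>) * G j \<omega>)
        = expectation (\<lambda>\<omega>. indicator {j} (J \<omega>) * g j)" for j
    proof -
      \<comment> \<open>Injectivity of \<open>real\<close> recovers the event that \<open>J\<close>
        equals \<open>j\<close> from the coerced index.\<close>
      have "indep_var borel (indicator {real j} \<circ> (\<lambda>\<omega>. real (J \<omega>))) borel ((\<lambda>u. u) \<circ> G j)"
        by (rule indep_var_compose[OF indep]) auto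
      moreover have "indicator {real j} \<circ> (\<lambda>\<omega>. real (J \<omega>)) = (\<lambda>\<omega>. indicator {j} (J \<omega>) :: real)"
        by (auto simp: indicator_def)
      ultimately have "indep_var borel (\<lambda>\<omega>. indicator {j} (J \<omega>) :: real) borel (G j)"
        by (simp add: comp_def)
      moreover have "integrable M (\<lambda>\<omega>. indicator {j} (J \<omega>) :: real)"
      proof (rule integrable_const_bound[where B = 1])
        show "(\<lambda>\<omega>. indicator {j} (J \<omega>) :: real) \<in> borel_measurable M"
          by (rule measurable_compose[OF J]) simp
      qed (auto simp: indicator_def)
      ultimately show ?thesis
        using indep_var_lebesgue_integral[OF _ _ int, of "\<lambda>\<omega>. indicator {j} (J \<omega>)" j] by (simp add: g_def)
    qed
    have "(\<integral>\<^sup>+\<omega>. ennreal (G (J \<omega>) \<omega>) \<partial>M)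
        = (\<Sum>j. ennreal (expectation (\<lambda>\<omega>. indicator {j} (J \<omega>) * G j \<omega>)))"
      by (rule sum_split) (use bounded in auto)
    also have "\<dots> = (\<integral>\<^sup>+\<omega>. ennreal (g (J \<omega>)) \<partial>M)"
      unfolding eq by (rule sum_split[symmetric]) (use g in auto)
    finally show ?thesis .
  qed
  moreover have "(\<lambda>\<omega>. G (J \<omega>) \<omega>) \<in> borel_measurable M"
    by (rule measurable_compose_countable[of G]) measurable
  then have "integrable M (\<lambda>\<omega>. G (J \<omega>) \<omega>)"
    using bounded by (intro integrable_const_bound[where B = 1]) auto
  moreover have "integrable M (\<lambda>\<omega>. g (J \<omega>))"
    using g by (intro integrable_const_bound[where B = 1]) auto
  ultimately have "ennreal (expectation (\<lambda>\<omega>. G (J \<omega>) \<omega>)) = ennreal (expectation (\<lambda>\<omega>. g (J \<omega>)))"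
    using bounded g by (simp add: nn_integral_eq_integral)
  moreover have "0 \<le> expectation (\<lambda>\<omega>. G (J \<omega>) \<omega>)" "0 \<le> expectation (\<lambda>\<omega>. g (J \<omega>))"
    using bounded g by (auto intro!: integral_nonneg_AE)
  ultimately show ?thesis
    by (simp add: g_def)
qed

section \<open>Maxima of a random number of i.i.d. variables\<close>

lemma prob_all_less_iid:
  assumes "iid_seq M X"
  shows "\<P>(\<omega> in M. \<forall>k\<in>{1..n}. X k \<omega> < y) = left_cdf M (X 1) y ^ n"
\<comment> \<open>For \<open>n = 0\<close> the intersection used below would be \<open>UNIV\<close>
  instead of \<open>space M\<close>; here both sides are simply 1.\<close>
proof (cases "n = 0")
  case True
  then show ?thesis by (simp add: prob_space)
next
  case False
  have indep: "indep_vars (\<lambda>_. borel) X {1..}"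
    and distr: "\<And>k. k \<ge> 1 \<Longrightarrow> distr M borel (X k) = distr M borel (X 1)"
    using assms unfolding iid_seq_def by blast+
  have X: "random_variable borel (X k)" if "k \<ge> 1" for k
    using indep that by (simp add: indep_vars_def)
  have "indep_vars (\<lambda>_. borel) X {1..n}"
    by (rule indep_vars_subset[OF indep]) auto
  from indep_varsD_finite[OF this, of "\<lambda>_. {..<y}"] False
  have "prob (\<Inter>k\<in>{1..n}. X k -` {..<y} \<inter> space M) = (\<Prod>k\<in>{1..n}. prob (X k -` {..<y} \<inter> space M))"
    by simp
  also have "\<dots> = (\<Prod>k\<in>{1..n}. left_cdf M (X 1) y)"
  proof (rule prod.cong)
    fix k assume "k \<in> {1..n}"
    then have k: "k \<ge> 1" by simp
    have "prob (X k -` {..<y} \<inter> space M) = measure (distr M borel (X k)) {..<y}"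
      using X[OF k] by (simp add: measure_distr)
    also have "\<dots> = measure (distr M borel (X 1)) {..<y}"
      using distr[OF k] by (rule arg_cong)
    also have "\<dots> = left_cdf M (X 1) y"
    proof -
      have "X 1 -` {..<y} \<inter> space M = {\<omega>\<in>space M. X 1 \<omega> < y}" by auto
      then show ?thesis
        using X[OF order_refl] by (simp add: measure_distr left_cdf_def del: One_nat_def)
    qed
    finally show "prob (X k -` {..<y} \<inter> space M) = left_cdf M (X 1) y" .
  qed simp
  also have "\<dots> = left_cdf M (X 1) y ^ n"
    by simp
  also have "(\<Inter>k\<in>{1..n}. X k -` {..<y} \<inter> space M) = {\<omega>\<in>space M. \<forall>k\<in>{1..n}. X k \<omega> < y}"
    using False by auto
  finally show ?thesis .
qed

end

text \<open>For \<open>n = 0\<close> the value \<open>-\<infinity>\<close> makes the left side true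
  and the right side is vacuous, so the empty maximum fits the general formula.\<close>

lemma norm_max_less_iff:
  assumes "\<beta> > 0"
  shows "ereal (1 / \<beta>) * (max_first X n \<omega> - ereal \<alpha>) < ereal x \<longleftrightarrow>
    (\<forall>k\<in>{1..n}. X k \<omega> < \<alpha> + \<beta> * x)"
proof (cases "n = 0")
  case False
  have "Max ((\<lambda>k. X k \<omega>) ` {1..n}) < \<alpha> + \<beta> * x \<longleftrightarrow> (\<forall>k\<in>{1..n}. X k \<omega> < \<alpha> + \<beta> * x)"
    using False by (subst Max_less_iff) auto
  then show ?thesis
    using assms False by (simp add: max_first_def field_simps)
qed (use assms in \<open>simp add: max_first_def\<close>)

text \<open>Given that \<open>N t\<close> equals \<open>n\<close>, all of the first \<open>n\<close>
  terms must stay below the level, which has probability \<open>F ^ n\<close> by independence. The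
  law of the maximum thus becomes the generating function of \<open>N t\<close>.\<close>

lemma norm_max_cdf_random_index:
  assumes "prob_space M" and iid: "iid_seq M X"
    and indep: "indep_processes M T (count_space UNIV) N {1..} borel X"
    and t: "t \<in> T" and N[measurable]: "N t \<in> measurable M (count_space UNIV)" and "\<beta> > 0"
  shows "norm_max_cdf M X (N t) \<alpha> \<beta> x = (\<integral>\<omega>. left_cdf M (X 1) (\<alpha> + \<beta> * x) ^ N t \<omega> \<partial>M)"
proof -
  interpret prob_space M by fact
  define y where "y = \<alpha> + \<beta> * x"
  define G where "G n \<omega> = (if \<forall>k\<in>{1..n}. X k \<omega> < y then 1 else 0 :: real)" for n \<omega>
  have indep_G: "indep_var borel (\<lambda>\<omega>. real (N t \<omega>)) borel (G n)" for n
  proof -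
    have "indep_var borel (\<lambda>\<omega>. (\<lambda>f. real (f t)) (\<lambda>s\<in>T. N s \<omega>))
       borel (\<lambda>\<omega>. (\<lambda>f. if \<forall>k\<in>{1..n}. f k < y then 1 else 0 :: real) (\<lambda>k\<in>{1..}. X k \<omega>))"
    proof (rule indep_processes_indep_var[OF indep])
      have [measurable]: "(\<lambda>f. f t) \<in> measurable (PiM T (\<lambda>_. count_space UNIV :: nat measure)) (count_space UNIV)"
        using t by (rule measurable_component_singleton)
      show "(\<lambda>f. real (f t)) \<in> borel_measurable (PiM T (\<lambda>_. count_space UNIV))"
        by measurable
      have [measurable]: "(\<lambda>f. f k) \<in> borel_measurable (PiM {1..} (\<lambda>_. borel :: real measure))"
        if "k \<in> {1..n}" for k
        using that by (intro measurable_component_singleton) simp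
      have "{f \<in> space (PiM {1..} (\<lambda>_. borel)). \<forall>k\<in>{1..n}. f k < y} \<in> sets (PiM {1..} (\<lambda>_. borel))"
        by (intro sets.sets_Collect_finite_All borel_measurable_less) auto
      then show "(\<lambda>f. if \<forall>k\<in>{1..n}. f k < y then 1 else 0 :: real)
          \<in> borel_measurable (PiM {1..} (\<lambda>_. borel))"
        by (intro measurable_If) auto
    qed auto
    moreover have "(\<forall>k\<in>{1..n}. (\<lambda>k\<in>{1..}. X k \<omega>) k < y) \<longleftrightarrow> (\<forall>k\<in>{1..n}. X k \<omega> < y)" for \<omega>
      by auto
    ultimately show ?thesis
      using t by (simp add: G_def[abs_def])
  qed
  \<comment> \<open>Arbitrary \<open>\<nu>\<close> covers both uses: the random number
    \<open>N t\<close> and a constant \<open>n\<close>.\<close>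
  have G_prob: "expectation (\<lambda>\<omega>. G (\<nu> \<omega>) \<omega>) = \<P>(\<omega> in M. \<forall>k\<in>{1..\<nu> \<omega>}. X k \<omega> < y)" for \<nu>
  proof -
    have "expectation (\<lambda>\<omega>. G (\<nu> \<omega>) \<omega>)
        = expectation (indicator {\<omega>\<in>space M. \<forall>k\<in>{1..\<nu> \<omega>}. X k \<omega> < y})"
      by (intro Bochner_Integration.integral_cong) (auto simp: G_def indicator_def)
    then show ?thesis by (simp add: Int_absorb2)
  qed
  have "norm_max_cdf M X (N t) \<alpha> \<beta> x = expectation (\<lambda>\<omega>. G (N t \<omega>) \<omega>)"
    using \<open>\<beta> > 0\<close> by (simp add: norm_max_cdf_def norm_max_less_iff G_prob y_def)
  also have "\<dots> = expectation (\<lambda>\<omega>. expectation (G (N t \<omega>)))"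
    by (intro expectation_random_index indep_G N) (auto simp: G_def)
  also have "\<dots> = expectation (\<lambda>\<omega>. left_cdf M (X 1) y ^ N t \<omega>)"
    using prob_all_less_iid[OF iid, of _ y] G_prob[of "\<lambda>_. n" for n] by simp
  finally show ?thesis by (simp add: y_def)
qed

section \<open>The generating function of a Cox process\<close>

lemma expectation_power_unit_poisson:
  assumes "unit_poisson_process M N\<^sub>1" and "s > 0"
  shows "(\<integral>\<omega>. c ^ N\<^sub>1 s \<omega> \<partial>M) = exp (- (s * (1 - c :: real)))"
proof -
  note N = assms(1)[unfolded unit_poisson_process_def]
  have [measurable]: "N\<^sub>1 s \<in> measurable M (count_space UNIV)"
    using N assms(2) by simp
  \<comment> \<open>As \<open>N\<^sub>1 0 = 0\<close>, the increment from time 0 is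
    \<open>N\<^sub>1 s\<close> itself.\<close>
  have "distr M (count_space UNIV) (\<lambda>\<omega>. N\<^sub>1 s \<omega> - N\<^sub>1 0 \<omega>) = measure_pmf (poisson_pmf (s - 0))"
    using N assms(2) by blast
  also have "distr M (count_space UNIV) (\<lambda>\<omega>. N\<^sub>1 s \<omega> - N\<^sub>1 0 \<omega>) = distr M (count_space UNIV) (N\<^sub>1 s)"
    using N by (intro distr_cong) auto
  finally have distr: "distr M (count_space UNIV) (N\<^sub>1 s) = measure_pmf (poisson_pmf s)" by simp
  have "(\<integral>\<omega>. c ^ N\<^sub>1 s \<omega> \<partial>M) = (\<integral>k. c ^ k \<partial>distr M (count_space UNIV) (N\<^sub>1 s))"
    by (rule integral_distr[symmetric]) auto
  then show ?thesis
    unfolding distr integral_power_poisson[OF assms(2)] .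
qed

text \<open>The successor of the floor, rather than the floor, stays strictly above \<open>l\<close>
  even when \<open>Suc n * l\<close> is an integer, with error at most \<open>1 / Suc n\<close>.
  Strictness gives convergence along \<open>at_right l\<close>, the filter in which right-continuity
  of paths is expressed.\<close>

lemma floor_approx_at_right:
  fixes l :: real
  assumes "l \<ge> 0"
  shows "filterlim (\<lambda>n. real (Suc (nat \<lfloor>real (Suc n) * l\<rfloor>)) / real (Suc n)) (at_right l) sequentially"
proof -
  let ?u = "\<lambda>n. real (Suc (nat \<lfloor>real (Suc n) * l\<rfloor>)) / real (Suc n)"
  have bounds: "l < ?u n" "?u n \<le> l + inverse (real (Suc n))" for n
  proof -
    define y where "y = real (Suc n) * l"
    have "0 \<le> y" using assms by (simp add: y_def)
    then have "real (Suc (nat \<lfloor>y\<rfloor>)) = of_int \<lfloor>y\<rfloor> + 1" by simp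
    then have "y < real (Suc (nat \<lfloor>y\<rfloor>))" "real (Suc (nat \<lfloor>y\<rfloor>)) \<le> y + 1"
      by linarith+
    then have "real (Suc n) * l < real (Suc (nat \<lfloor>real (Suc n) * l\<rfloor>))"
      "real (Suc (nat \<lfloor>real (Suc n) * l\<rfloor>)) \<le> real (Suc n) * l + 1"
      unfolding y_def .
    then show "l < ?u n" "?u n \<le> l + inverse (real (Suc n))"
      by (simp_all add: divide_simps distrib_left mult.commute del: of_nat_Suc)
  qed
  have "?u \<longlonglongrightarrow> l"
  proof (rule tendsto_sandwich[where f = "\<lambda>_. l" and h = "\<lambda>n. l + inverse (real (Suc n))"])
    show "(\<lambda>n. l + inverse (real (Suc n))) \<longlonglongrightarrow> l"
      by (rule LIMSEQ_inverse_real_of_nat_add)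
  qed (use bounds(2) less_imp_le[OF bounds(1)] in \<open>auto intro!: always_eventually simp del: of_nat_Suc\<close>)
  then show ?thesis
    using bounds(1) by (simp add: filterlim_at less_imp_neq[symmetric] del: of_nat_Suc)
qed

lemma cox_process_finite:
  assumes "cox_process M N\<^sub>1 L N" "t \<ge> 0"
  shows "AE \<omega> in M. L t \<omega> < \<infinity>"
proof (cases "t = 0")
  case True
  then show ?thesis
    using assms by (auto simp: cox_process_def controlling_process_def)
next
  case False
  then show ?thesis
    using assms by (simp add: cox_process_def controlling_process_def)
qed

text \<open>The paths of \<open>N\<^sub>1\<close> are only known to be right-continuous, so \<open>N\<^sub>1\<close> cannot simply be composed with
  the law of \<open>L t\<close>. Approximating \<open>L t\<close> strictly from above by variables with countably many values
  reduces the claim to independence at fixed times.\<close>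

lemma cox_process_generating_function:
  assumes "prob_space M" and cox: "cox_process M N\<^sub>1 L N" and t: "t \<ge> 0"
    and c: "0 \<le> c" "c \<le> (1 :: real)"
  shows "(\<integral>\<omega>. c ^ N t \<omega> \<partial>M) = (\<integral>\<omega>. exp (- (enn2real (L t \<omega>) * (1 - c))) \<partial>M)"
proof -
  interpret prob_space M by fact
  have N1: "unit_poisson_process M N\<^sub>1" and L: "controlling_process M L"
    and indep: "indep_processes M {0..} (count_space UNIV) N\<^sub>1 {0..} borel L"
    and N_meas[measurable]: "N t \<in> measurable M (count_space UNIV)"
    and N: "\<And>\<omega>. \<omega> \<in> space M \<Longrightarrow> L t \<omega> < \<infinity> \<Longrightarrow> N t \<omega> = N\<^sub>1 (enn2real (L t \<omega>)) \<omega>"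
    using cox t by (auto simp: cox_process_def)
  have [measurable]: "L t \<in> borel_measurable M"
    using L t by (simp add: controlling_process_def)
  have L_finite: "AE \<omega> in M. L t \<omega> < \<infinity>"
    using cox t by (rule cox_process_finite)
  \<comment> \<open>\<open>J n\<close> indexes the cell of mesh \<open>1 / Suc n\<close> that
    contains \<open>L t\<close>, and \<open>u n (J n \<omega>)\<close> is its right endpoint. The
    default \<open>enn2real \<infinity> = 0\<close> is used only on a null event.\<close>
  define J where "J n \<omega> = nat \<lfloor>real (Suc n) * enn2real (L t \<omega>)\<rfloor>" for n \<omega>
  define u where "u n j = real (Suc j) / real (Suc n)" for n j
  have u_pos: "u n j > 0" for n j by (simp add: u_def)
  have J_meas[measurable]: "J n \<in> measurable M (count_space UNIV)" for n
    unfolding J_def by measurable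
  have N1_meas[measurable]: "N\<^sub>1 (u n j) \<in> measurable M (count_space UNIV)" for n j
    using N1 u_pos[of n j] by (simp add: unit_poisson_process_def)
  have lim_u: "filterlim (\<lambda>n. u n (J n \<omega>)) (at_right (enn2real (L t \<omega>))) sequentially" for \<omega>
    unfolding u_def J_def by (rule floor_approx_at_right) simp
  have step: "expectation (\<lambda>\<omega>. c ^ N\<^sub>1 (u n (J n \<omega>)) \<omega>)
      = expectation (\<lambda>\<omega>. exp (- (u n (J n \<omega>) * (1 - c))))" for n
  proof -
    have "indep_var borel (\<lambda>\<omega>. real (J n \<omega>)) borel (\<lambda>\<omega>. c ^ N\<^sub>1 (u n j) \<omega>)" for j
    proof -
      have "indep_var borel
          (\<lambda>\<omega>. (\<lambda>f. real (nat \<lfloor>real (Suc n) * enn2real (f t)\<rfloor>)) (\<lambda>s\<in>{0..}. L s \<omega>))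
          borel (\<lambda>\<omega>. (\<lambda>f. c ^ f (u n j)) (\<lambda>s\<in>{0..}. N\<^sub>1 s \<omega>))"
      proof (rule indep_processes_indep_var[OF indep_processes_sym[OF \<open>prob_space M\<close> indep]])
        have [measurable]: "(\<lambda>f. f t) \<in> borel_measurable (PiM {0..} (\<lambda>_. borel :: ennreal measure))"
          using t by (intro measurable_component_singleton) simp
        show "(\<lambda>f. real (nat \<lfloor>real (Suc n) * enn2real (f t)\<rfloor>))
            \<in> borel_measurable (PiM {0..} (\<lambda>_. borel))"
          by measurable
        have "(\<lambda>f. f (u n j)) \<in>
            measurable (PiM {0..} (\<lambda>_. count_space UNIV :: nat measure)) (count_space UNIV)"
          using u_pos[of n j] by (intro measurable_component_singleton) simp
        then show "(\<lambda>f. c ^ f (u n j)) \<in> borel_measurable (PiM {0..} (\<lambda>_. count_space UNIV))"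
          by (rule measurable_compose) simp
      qed auto
      then show ?thesis
        using t u_pos[of n j] by (simp add: J_def[abs_def])
    qed
    then have "expectation (\<lambda>\<omega>. c ^ N\<^sub>1 (u n (J n \<omega>)) \<omega>)
        = expectation (\<lambda>\<omega>. expectation (\<lambda>\<omega>'. c ^ N\<^sub>1 (u n (J n \<omega>)) \<omega>'))"
      using c by (intro expectation_random_index J_meas) (auto intro: power_le_one)
    \<comment> \<open>The Poisson formula applies at every grid time, all of which are positive
      thanks to the successor in \<open>u\<close>.\<close>
    then show ?thesis
      by (simp only: expectation_power_unit_poisson[OF N1 u_pos])
  qed
  have "(\<lambda>n. expectation (\<lambda>\<omega>. c ^ N\<^sub>1 (u n (J n \<omega>)) \<omega>))
      \<longlonglongrightarrow> expectation (\<lambda>\<omega>. c ^ N t \<omega>)"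
  proof (rule integral_dominated_convergence[where w = "\<lambda>_. 1"])
    show "AE \<omega> in M. (\<lambda>n. c ^ N\<^sub>1 (u n (J n \<omega>)) \<omega>) \<longlonglongrightarrow> c ^ N t \<omega>"
      using L_finite AE_space
    proof eventually_elim
      case (elim \<omega>)
      have "continuous (at_right (enn2real (L t \<omega>))) (\<lambda>s. N\<^sub>1 s \<omega>)"
        using N1 elim by (simp add: unit_poisson_process_def)
      then have "((\<lambda>s. N\<^sub>1 s \<omega>) \<longlongrightarrow> N t \<omega>) (at_right (enn2real (L t \<omega>)))"
        using N elim by (simp add: continuous_within)
      then have "((\<lambda>n. N\<^sub>1 (u n (J n \<omega>)) \<omega>) \<longlonglongrightarrow> N t \<omega>)"
        by (rule filterlim_compose[OF _ lim_u])
      then show ?case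
        \<comment> \<open>Convergence in \<open>nat\<close> is eventual equality, which carries over
          to the powers of \<open>c\<close>.\<close>
        unfolding tendsto_discrete by (rule tendsto_eventually[OF eventually_mono]) simp
    qed
    show "(\<lambda>\<omega>. c ^ N\<^sub>1 (u n (J n \<omega>)) \<omega>) \<in> borel_measurable M" for n
      by (rule measurable_compose_countable[of "\<lambda>j \<omega>. c ^ N\<^sub>1 (u n j) \<omega>", OF measurable_compose[OF N1_meas] J_meas]) simp
  qed (use c in \<open>auto intro!: power_le_one\<close>)
  moreover have "(\<lambda>n. expectation (\<lambda>\<omega>. exp (- (u n (J n \<omega>) * (1 - c)))))
      \<longlonglongrightarrow> expectation (\<lambda>\<omega>. exp (- (enn2real (L t \<omega>) * (1 - c))))"
  proof (rule integral_dominated_convergence[where w = "\<lambda>_. 1"])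
    have "(\<lambda>n. u n (J n \<omega>)) \<longlonglongrightarrow> enn2real (L t \<omega>)" for \<omega>
      using lim_u[of \<omega>] by (simp add: filterlim_at)
    then show "AE \<omega> in M. (\<lambda>n. exp (- (u n (J n \<omega>) * (1 - c))))
        \<longlonglongrightarrow> exp (- (enn2real (L t \<omega>) * (1 - c)))"
      by (intro AE_I2 tendsto_intros)
    show "(\<lambda>\<omega>. exp (- (u n (J n \<omega>) * (1 - c)))) \<in> borel_measurable M" for n
      unfolding u_def by measurable
    show "AE \<omega> in M. norm (exp (- (u n (J n \<omega>) * (1 - c)))) \<le> 1" for n
      using c u_pos by (simp add: less_imp_le)
  qed auto
  ultimately show ?thesis
    unfolding step by (rule LIMSEQ_unique)
qed

section \<open>Combination of the two comparisons\<close>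

theorem theorem8:
  fixes M :: "'a measure" and P :: "'b measure"
    and X :: "nat \<Rightarrow> 'a \<Rightarrow> real"
    and N\<^sub>1 N :: "real \<Rightarrow> 'a \<Rightarrow> nat"
    and L :: "real \<Rightarrow> 'a \<Rightarrow> ennreal"
    and \<Lambda> :: "'b \<Rightarrow> real"
    and H :: "real \<Rightarrow> real" and \<tau> :: real
    and a b d :: "real \<Rightarrow> real"
    and t x q :: real and m :: nat
  assumes "prob_space M"
    and "iid_seq M X"
    and "extreme_value_df \<tau> H"
    and "in_max_DA M X H"
    and "cox_process M N\<^sub>1 L N"
    and "indep_processes M {0..} (count_space UNIV) N {1..} borel X"
    and "prob_space P"
    and "\<Lambda> \<in> borel_measurable P"
    and "AE \<omega> in P. 0 \<le> \<Lambda> \<omega>"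
    and "\<forall>s\<ge>0. b s > 0"
    and "\<forall>s\<ge>0. d s > 0"
    and "t \<ge> 0"
    and "H x > 0"
    and "0 < q" and "q < 1"
    and "m \<ge> 1"
  shows "let z = d t * (1 - left_cdf M (X 1) (a t + b t * x));
             r = z + ln (H x)
         in ennreal \<bar>norm_max_cdf M X (N t) (a t) (b t) x - (\<integral>\<omega>. H x powr \<Lambda> \<omega> \<partial>P)\<bar>
            \<le> (if r = 0 then 0
                else ennreal \<bar>r\<bar> *
                       (\<Sum>k=1..m. ennreal (B_coeff k m q * \<bar>r\<bar> ^ (k - 1)) *
                          (\<integral>\<^sup>+\<omega>. ennreal (\<Lambda> \<omega> ^ k * H x powr \<Lambda> \<omega>) \<partial>P))
                     + ennreal \<P>(\<omega> in P. \<Lambda> \<omega> > q / \<bar>r\<bar>))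
              + ennreal z *
                  (\<integral>\<^sup>+l\<in>{0..}. ennreal (\<bar>\<P>(\<omega> in M. L t \<omega> < ennreal (l * d t)) - \<P>(\<omega> in P. \<Lambda> \<omega> < l)\<bar>
                       * exp (- l * z)) \<partial>lborel)"
proof -
  interpret prob_space M by fact
  let ?y = "a t + b t * x"
  let ?F = "left_cdf M (X 1) ?y"
  define z where "z = d t * (1 - ?F)"
  define r where "r = z + ln (H x)"
  define U where "U \<omega> = enn2real (L t \<omega>) / d t" for \<omega>
  have d: "d t > 0" and b: "b t > 0"
    using assms by auto
  have F: "0 \<le> ?F" "?F \<le> 1"
    by (auto simp: left_cdf_def)
  have z: "z \<ge> 0"
    using d F by (simp add: z_def)
  have cox: "cox_process M N\<^sub>1 L N" and N: "N t \<in> measurable M (count_space UNIV)"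
    using assms by (auto simp: cox_process_def)
  then have L[measurable]: "L t \<in> borel_measurable M"
    using \<open>t \<ge> 0\<close> by (simp add: cox_process_def controlling_process_def)
  have L_finite: "AE \<omega> in M. L t \<omega> < \<infinity>"
    using cox \<open>t \<ge> 0\<close> by (rule cox_process_finite)
  have U: "U \<in> borel_measurable M" "AE \<omega> in M. 0 \<le> U \<omega>"
    unfolding U_def using d by auto
  \<comment> \<open>The two events can disagree where \<open>L t\<close> is infinite, because
    \<open>U\<close> takes the default value 0 there; this set is null.\<close>
  have U_cdf: "\<P>(\<omega> in M. L t \<omega> < ennreal (l * d t)) = \<P>(\<omega> in M. U \<omega> < l)" if "l \<ge> 0" for l
  proof (rule measure_eq_AE)
    show "AE \<omega> in M. \<omega> \<in> {\<omega>\<in>space M. L t \<omega> < ennreal (l * d t)}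
        \<longleftrightarrow> \<omega> \<in> {\<omega>\<in>space M. U \<omega> < l}"
      using L_finite
    proof eventually_elim
      case (elim \<omega>)
      then obtain v where "L t \<omega> = ennreal v" "v \<ge> 0"
        by (cases "L t \<omega>") auto
      then show ?case
        using d by (simp add: U_def ennreal_less_iff pos_divide_less_eq)
    qed
  qed (use U(1) in measurable)
  have "norm_max_cdf M X (N t) (a t) (b t) x = expectation (\<lambda>\<omega>. ?F ^ N t \<omega>)"
    using assms N b by (intro norm_max_cdf_random_index) auto
  also have "\<dots> = expectation (\<lambda>\<omega>. exp (- (enn2real (L t \<omega>) * (1 - ?F))))"
    using assms F by (intro cox_process_generating_function) auto
  also have "\<dots> = expectation (\<lambda>\<omega>. exp (- U \<omega> * z))"
    using d by (simp add: U_def z_def)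
  finally have cdf: "norm_max_cdf M X (N t) (a t) (b t) x = expectation (\<lambda>\<omega>. exp (- U \<omega> * z))" .
  let ?E = "\<integral>\<omega>. exp (- \<Lambda> \<omega> * z) \<partial>P"
  let ?I = "\<integral>\<omega>. H x powr \<Lambda> \<omega> \<partial>P"
  let ?R = "if r = 0 then 0 else ennreal \<bar>r\<bar> *
      (\<Sum>k=1..m. ennreal (B_coeff k m q * \<bar>r\<bar> ^ (k - 1)) *
        (\<integral>\<^sup>+\<omega>. ennreal (\<Lambda> \<omega> ^ k * H x powr \<Lambda> \<omega>) \<partial>P))
      + ennreal \<P>(\<omega> in P. \<Lambda> \<omega> > q / \<bar>r\<bar>)"
  have "ennreal \<bar>expectation (\<lambda>\<omega>. exp (- U \<omega> * z)) - ?E\<bar>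
    \<le> ennreal z * (\<integral>\<^sup>+l\<in>{0..}. ennreal (\<bar>\<P>(\<omega> in M. U \<omega> < l) - \<P>(\<omega> in P. \<Lambda> \<omega> < l)\<bar>
        * exp (- l * z)) \<partial>lborel)"
    using assms U z by (intro laplace_difference_le) auto
  also have "(\<integral>\<^sup>+l\<in>{0..}. ennreal (\<bar>\<P>(\<omega> in M. U \<omega> < l) - \<P>(\<omega> in P. \<Lambda> \<omega> < l)\<bar>
        * exp (- l * z)) \<partial>lborel)
    = (\<integral>\<^sup>+l\<in>{0..}. ennreal (\<bar>\<P>(\<omega> in M. L t \<omega> < ennreal (l * d t)) - \<P>(\<omega> in P. \<Lambda> \<omega> < l)\<bar>
        * exp (- l * z)) \<partial>lborel)" (is "_ = ?J")
    by (rule nn_integral_cong) (simp add: U_cdf indicator_def)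
  finally have mixing: "ennreal \<bar>expectation (\<lambda>\<omega>. exp (- U \<omega> * z)) - ?E\<bar> \<le> ennreal z * ?J" .
  have extreme: "ennreal \<bar>?E - ?I\<bar> \<le> ?R"
  proof (cases "r = 0")
    \<comment> \<open>Here \<open>q / \<bar>r\<bar>\<close> would be \<open>q / 0 = 0\<close>, hence
      the separate convention; \<open>r = 0\<close> makes \<open>?E\<close> and \<open>?I\<close>
      coincide, so the bound 0 is correct.\<close>
    case True
    then have "ln (H x) = - z"
      by (simp add: r_def)
    then have "?E = ?I"
      using \<open>H x > 0\<close> by (simp add: powr_def)
    then show ?thesis by simp
  next
    case False
    have "ennreal \<bar>?E - ?I\<bar> \<le> ennreal \<bar>r\<bar> *
        (\<Sum>k=1..m. ennreal (B_coeff k m q * \<bar>r\<bar> ^ (k - 1)) *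
          (\<integral>\<^sup>+\<omega>. ennreal (\<Lambda> \<omega> ^ k * H x powr \<Lambda> \<omega>) \<partial>P))
        + ennreal \<P>(\<omega> in P. \<Lambda> \<omega> > q / \<bar>r\<bar>)"
      by (rule powr_mean_difference_le[OF _ _ _ z])
        (use assms False extreme_value_df_le_one r_def in auto)
    then show ?thesis using False by simp
  qed
  have "ennreal \<bar>expectation (\<lambda>\<omega>. exp (- U \<omega> * z)) - ?I\<bar>
      \<le> ennreal (\<bar>?E - ?I\<bar> + \<bar>expectation (\<lambda>\<omega>. exp (- U \<omega> * z)) - ?E\<bar>)"
    by (intro ennreal_leI) linarith
  also have "\<dots> = ennreal \<bar>?E - ?I\<bar> + ennreal \<bar>expectation (\<lambda>\<omega>. exp (- U \<omega> * z)) - ?E\<bar>"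
    by (rule ennreal_plus) auto
  also have "\<dots> \<le> ?R + ennreal z * ?J"
    by (intro add_mono extreme mixing)
  finally show ?thesis
    unfolding cdf Let_def z_def[symmetric] r_def[symmetric] .
qed

end
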